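(* Let $Q$ be an antichain (i.e. $\le_Q$ is equality), let $X$ be a countably based $T_0$-space with Borel base $\mathcal{L}(X)$, and let $u\in\mathbb{T}_\sigma$. Then $\mathcal{L}(X,u)$ is closed downwards under Wadge reducibility: if $A,B:X\to Q$, $B\in\mathcal{L}(X,u)$ and $A\le_W B$, then $A\in\mathcal{L}(X,u)$.
   Context: Trees. $\omega^*$ is the set of finite strings over $\omega$, $\varepsilon$ the empty string, $\sqsubseteq$ the prefix order. A tree is a non-empty prefix-closed $T\subseteq\omega^*$; it is well founded if it has no infinite path, and infinite-branching if every non-leaf $\tau\in T$ has $\tau i\in T$ for all $i<\omega$. Terms. For a quasiorder $Q$, $\mathbb{T}_\sigma$ is the set of variable-free terms defined inductively from constants $q\in Q$, unary symbols $s_\alpha$ ($\alpha<\omega_1$) and $\omega$-ary symbols $F_q$ ($q\in Q$) and $F_\alpha$ ($\alpha<\omega_1$), all symbols being distinct. To each $u\in\mathbb{T}_\sigma$ one associates an infinite-branching well founded tree $T$ with a labeling $t$ of its nodes by terms, written $T(u)=(T,t)$: $T(q)$ and $T(s_\alpha(u))$ are the one-node tree $\{\varepsilon\}$ labeled by $q$, resp. by $s_\alpha(u)$; $T(F_q(u_0,u_1,\ldots))$ has root labeled $q$, and its labeled subtree above the node $i$ is $T(u_i)$ for each $i\ge0$; $T(F_\alpha(u_0,u_1,\ldots))$ has root labeled $s_\alpha(u_0)$, and its labeled subtree above the node $i$ is $T(u_{i+1})$ for each $i\ge0$. Bases. A base in a set $X$ is a sequence $\mathcal{L}(X)=\{\mathcal{L}_\alpha(X)\}_{\alpha<\omega_1}$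 of subsets of $P(X)$, each closed under countable unions and finite intersections, such that for $\alpha<\beta$ all sets of $\mathcal{L}_\alpha$ and their complements belong to $\mathcal{L}_\beta$. The $\beta$-shift is the base $\mathcal{L}^\beta(X)=\{\mathcal{L}_{\beta+\alpha}(X)\}_{\alpha<\omega_1}$; for $U\subseteq X$, the $U$-restriction $\mathcal{L}(U)$ is the base in $U$ with levels $\{U\cap S\mid S\in\mathcal{L}_\alpha(X)\}$. The Borel base in a space $X$ is $\{\mathbf{\Sigma}^0_{1+\alpha}(X)\}_{\alpha<\omega_1}$, where $\mathbf{\Sigma}^0_1$ is the class of open sets, $\mathbf{\Sigma}^0_2$ the class of countable unions of differences of open sets, and, for $\alpha>2$, $\mathbf{\Sigma}^0_\alpha$ the class of countable unions of complements of sets in $\bigcup_{\beta<\alpha}\mathbf{\Sigma}^0_\beta$. Families. For a well founded tree $T$, a $T$-family $\{U_\tau\}_{\tau\in T}$ of subsets of $X$ is monotone if $U_\tau\supseteq U_{\tau'}$ whenever $\tau\sqsubseteq\tau'$ in $T$; its components are $\tilde U_\tau=U_\tau\setminus\bigcup\{U_{\tau'}\mid\tau\sqsubset\tau'\in T\}$. The notions "$F$ is a $u$-family in $\mathcal{L}(X)$" and "$F$ determines $A:X\to Q$" are defined by induction, simultaneously for all bases: (i) the only $q$-family is $\{X\}$, and it determines exactly the constant function $\lambda x.q$; (ii) an $s_\alpha(u)$-family in $\mathcal{L}(X)$ is a $u$-family in $\mathcal{L}^{\omega^\alpha}(X)$, and it determines $A$ iff it determines $A$ as a $u$-family in $\mathcal{L}^{\omega^\alpha}(X)$;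 (iii) if $u=F_q(u_0,\ldots)$ or $u=F_\alpha(u_0,\ldots)$ and $T(u)=(T,t)$, a $u$-family is a pair $(\{U_\tau\}_{\tau\in T},\{F_\tau\}_{\tau\in T})$ where $\{U_\tau\}$ is a monotone $T$-family of $\mathcal{L}_0(X)$-sets with $U_\varepsilon=X$ and each $F_\tau$ is a $t(\tau)$-family in $\mathcal{L}(\tilde U_\tau)$; it determines $A$ iff $F_\tau$ determines $A|_{\tilde U_\tau}$ for every $\tau\in T$. $\mathcal{L}(X,u)$ is the set of all $A:X\to Q$ determined by some $u$-family in $\mathcal{L}(X)$. Wadge reducibility. For $A,B:X\to Q$, $A\le_W B$ means that there is a continuous $f:X\to X$ with $A(x)\le_Q B(f(x))$ for all $x\in X$. *)

theory Defs
  imports "HOL-Analysis.Analysis" "HOL-Library.Sublist" "HOL-Library.Countable_Set_Type"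
begin

section \<open>Countable ordinals\<close>

text \<open>The type of ordinals below \<open>\<omega>\<^sub>1\<close>, carried by the successor cardinal of \<open>\<aleph>\<^sub>0\<close>.\<close>

typedef omega1 = "Field (cardSuc natLeq)"
proof -
  have "infinite (Field (cardSuc natLeq))"
    by (simp add: cardSuc_finite[OF natLeq_Card_order] Field_natLeq)
  then show ?thesis
    using infinite_imp_nonempty by blast
qed

lemma cardSuc_natLeq_Well_order: "Well_order (cardSuc natLeq)"
  using cardSuc_Card_order[OF natLeq_Card_order] card_order_on_well_order_on by blast

instantiation omega1 :: wellorder
begin

definition less_eq_omega1 :: "omega1 \<Rightarrow> omega1 \<Rightarrow> bool" where
  "a \<le> b \<longleftrightarrow> (Rep_omega1 a, Rep_omega1 b) \<in> cardSuc natLeq"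

definition less_omega1 :: "omega1 \<Rightarrow> omega1 \<Rightarrow> bool" where
  "a < b \<longleftrightarrow> (a :: omega1) \<le> b \<and> a \<noteq> b"

instance
proof
  note wo = cardSuc_natLeq_Well_order[unfolded order_on_defs]
  fix x y z :: omega1
  show "x \<le> x"
    using wo Rep_omega1[of x] by (auto simp: less_eq_omega1_def refl_on_def)
  have "trans (cardSuc natLeq)" "antisym (cardSuc natLeq)"
    using wo by simp_all
  then show "x \<le> z" if "x \<le> y" "y \<le> z"
    using that transD unfolding less_eq_omega1_def by metis
  have anti: "x = y" if "x \<le> y" "y \<le> x" for x y :: omega1
    using \<open>antisym (cardSuc natLeq)\<close> that
    unfolding less_eq_omega1_def by (metis antisymD Rep_omega1_inject)
  show "x = y" if "x \<le> y" "y \<le> x"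
    using that by (rule anti)
  show "(x < y) = (x \<le> y \<and> \<not> y \<le> x)"
    using anti by (auto simp: less_omega1_def)
  show "x \<le> y \<or> y \<le> x"
  proof (cases "x = y")
    case True
    then show ?thesis
      using wo Rep_omega1[of x] by (auto simp: less_eq_omega1_def refl_on_def)
  next
    case False
    then show ?thesis
      using wo Rep_omega1[of x] Rep_omega1[of y]
      by (auto simp: less_eq_omega1_def total_on_def Rep_omega1_inject)
  qed
  show "P a" if step: "\<And>x. (\<And>y. y < x \<Longrightarrow> P y) \<Longrightarrow> P x" for P and a :: omega1
  proof -
    have wf: "wf (inv_image (cardSuc natLeq - Id) Rep_omega1)"
      using wo by (intro wf_inv_image) simp
    show ?thesis
      by (rule wf_induct_rule[OF wf], rule step)
        (auto simp: less_omega1_def less_eq_omega1_def Rep_omega1_inject)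
  qed
qed

end

lemma uncountable_omega1:
  includes cardinal_syntax
  shows "uncountable (UNIV :: omega1 set)"
proof
  assume "countable (UNIV :: omega1 set)"
  then have "countable (range Rep_omega1)"
    by simp
  then have "|Field (cardSuc natLeq)| \<le>o natLeq"
    by (simp add: countable_card_le_natLeq type_definition.Rep_range[OF type_definition_omega1])
  moreover have "(card_of (Field (cardSuc natLeq)), cardSuc natLeq) \<in> ordIso"
    by (simp add: card_of_Field_ordIso cardSuc_Card_order natLeq_Card_order)
  ultimately have "cardSuc natLeq \<le>o natLeq"
    using ordIso_ordLeq_trans ordIso_symmetric by blast
  then show False
    using cardSuc_greater[OF natLeq_Card_order] not_ordLess_ordLeq by blast
qed

lemma countable_lessThan_omega1:
  includes cardinal_syntax
  shows "countable {..<a :: omega1}"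
proof -
  have "|underS (cardSuc natLeq) (Rep_omega1 a)| <o cardSuc natLeq"
    by (simp add: card_of_underS cardSuc_Card_order natLeq_Card_order Rep_omega1)
  then have "|underS (cardSuc natLeq) (Rep_omega1 a)| \<le>o natLeq"
    by (simp add: cardSuc_ordLeq_ordLess natLeq_Card_order card_of_Card_order)
  then have "countable (underS (cardSuc natLeq) (Rep_omega1 a))"
    by (simp add: countable_card_le_natLeq)
  moreover have "Rep_omega1 ` {..<a} \<subseteq> underS (cardSuc natLeq) (Rep_omega1 a)"
    by (auto simp: underS_def less_omega1_def less_eq_omega1_def Rep_omega1_inject)
  ultimately have "countable (Rep_omega1 ` {..<a})"
    using countable_subset by blast
  then show ?thesis
    by (rule countable_image_inj_on) (simp add: Rep_omega1_inject inj_on_def)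
qed

lemma countable_bounded_omega1:
  fixes A :: "omega1 set"
  assumes "countable A"
  shows "\<exists>b. \<forall>a\<in>A. a < b"
proof (rule ccontr)
  assume "\<nexists>b. \<forall>a\<in>A. a < b"
  then have "\<exists>a\<in>A. b \<le> a" for b
    by (simp add: not_less)
  then have "(UNIV :: omega1 set) \<subseteq> (\<Union>a\<in>A. insert a {..<a})"
    by (auto simp: le_less)
  moreover have "countable (\<Union>a\<in>A. insert a {..<a})"
    using assms countable_lessThan_omega1 by auto
  ultimately show False
    using uncountable_omega1 countable_subset by blast
qed

definition ord_sup :: "omega1 set \<Rightarrow> omega1" where
  "ord_sup A = (LEAST b. \<forall>a\<in>A. a \<le> b)"

lemma ord_sup_le_iff:
  assumes "countable A"
  shows "ord_sup A \<le> b \<longleftrightarrow> (\<forall>a\<in>A. a \<le> b)"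
proof -
  obtain c where "\<forall>a\<in>A. a < c"
    using countable_bounded_omega1[OF assms] by blast
  then have "\<forall>a\<in>A. a \<le> c"
    by auto
  then have "\<forall>a\<in>A. a \<le> ord_sup A"
    unfolding ord_sup_def by (rule LeastI)
  moreover have "ord_sup A \<le> b" if "\<forall>a\<in>A. a \<le> b"
    unfolding ord_sup_def using that by (rule Least_le)
  ultimately show ?thesis
    by (meson order.trans)
qed

definition ord_suc :: "omega1 \<Rightarrow> omega1" where
  "ord_suc a = (LEAST b. a < b)"

lemma less_ord_suc: "a < ord_suc a"
proof -
  obtain b where "a < b"
    using countable_bounded_omega1[of "{a}"] by auto
  then show ?thesis
    unfolding ord_suc_def by (rule LeastI)
qed

lemma ord_suc_le_iff: "ord_suc a \<le> b \<longleftrightarrow> a < b"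
proof
  show "ord_suc a \<le> b" if "a < b"
    unfolding ord_suc_def using that by (rule Least_le)
  show "a < b" if "ord_suc a \<le> b"
    using less_ord_suc that by (rule less_le_trans)
qed

lemma less_ord_suc_iff: "b < ord_suc a \<longleftrightarrow> b \<le> a"
  using ord_suc_le_iff[of a b] by (simp add: not_le[symmetric])

instantiation omega1 :: "{zero, one}"
begin

definition zero_omega1 :: omega1 where
  "0 = (LEAST a :: omega1. True)"

definition one_omega1 :: omega1 where
  "1 = ord_suc (0 :: omega1)"

instance ..

end

lemma zero_le_omega1 [simp]: "(0 :: omega1) \<le> a"
  by (simp add: zero_omega1_def Least_le)

text \<open>The recursions below are the uniform supremum forms of the usual three-case recursions for
  the ordinal operations.\<close>

function ord_add :: "omega1 \<Rightarrow> omega1 \<Rightarrow> omega1" where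
  "ord_add a b = ord_sup (insert a ((\<lambda>b'. ord_suc (ord_add a b')) ` {..<b}))"
  by pat_completeness auto
termination
proof (relation "inv_image {(x, y). x < y} snd")
  show "wf (inv_image {(x :: omega1, y). x < y} (snd :: omega1 \<times> omega1 \<Rightarrow> omega1))"
    by (intro wf_inv_image wf)
qed simp

declare ord_add.simps [simp del]

function ord_mult :: "omega1 \<Rightarrow> omega1 \<Rightarrow> omega1" where
  "ord_mult a b = ord_sup ((\<lambda>b'. ord_add (ord_mult a b') a) ` {..<b})"
  by pat_completeness auto
termination
proof (relation "inv_image {(x, y). x < y} snd")
  show "wf (inv_image {(x :: omega1, y). x < y} (snd :: omega1 \<times> omega1 \<Rightarrow> omega1))"
    by (intro wf_inv_image wf)
qed simp

declare ord_mult.simps [simp del]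

definition ord_omega :: omega1 where
  "ord_omega = (LEAST a. 0 < a \<and> (\<forall>b<a. ord_suc b < a))"

function omega_pow :: "omega1 \<Rightarrow> omega1" where
  "omega_pow a = ord_sup (insert 1 ((\<lambda>b. ord_mult (omega_pow b) ord_omega) ` {..<a}))"
  by pat_completeness auto
termination
proof (relation "{(x, y). x < y}")
  show "wf {(x :: omega1, y). x < y}"
    by (rule wf)
qed simp

declare omega_pow.simps [simp del]

lemma eq_by_le_iff: "(\<And>c :: omega1. x \<le> c \<longleftrightarrow> y \<le> c) \<Longrightarrow> x = y"
  by (meson antisym order.refl)

lemma ord_omega_spec: "0 < ord_omega \<and> (\<forall>b<ord_omega. ord_suc b < ord_omega)"
proof -
  obtain c where c: "\<forall>a\<in>range (\<lambda>n. (ord_suc ^^ n) 0). a < c"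
    using countable_bounded_omega1[of "range (\<lambda>n. (ord_suc ^^ n) 0)"] by auto
  define l where "l = (LEAST c. \<forall>n. (ord_suc ^^ n) 0 < c)"
  have l: "\<forall>n. (ord_suc ^^ n) 0 < l"
    unfolding l_def by (rule LeastI[of _ c]) (use c in auto)
  have "ord_suc b < l" if "b < l" for b
  proof -
    have "\<not> (\<forall>n. (ord_suc ^^ n) 0 < b)"
      using not_less_Least that unfolding l_def by blast
    then obtain n where "b \<le> (ord_suc ^^ n) 0"
      by (auto simp: not_less)
    then have "ord_suc b \<le> (ord_suc ^^ Suc n) 0"
      by (simp add: ord_suc_le_iff less_ord_suc_iff)
    also have "\<dots> < l"
      using l by blast
    finally show ?thesis .
  qed
  moreover have "0 < l"
    using l[rule_format, of 0] by simp
  ultimately have "0 < l \<and> (\<forall>b<l. ord_suc b < l)"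
    by blast
  then show ?thesis
    unfolding ord_omega_def by (rule LeastI)
qed

lemma not_less_zero_omega1 [simp]: "\<not> (a :: omega1) < 0"
  by (simp add: not_less)

lemma ord_omega_limit: "0 < ord_omega" "b < ord_omega \<Longrightarrow> ord_suc b < ord_omega"
  using ord_omega_spec by auto

lemma ord_add_le_iff: "ord_add a b \<le> c \<longleftrightarrow> a \<le> c \<and> (\<forall>b'<b. ord_add a b' < c)"
  by (subst ord_add.simps) (auto simp: ord_sup_le_iff countable_lessThan_omega1 ord_suc_le_iff)

lemma ord_mult_le_iff: "ord_mult a b \<le> c \<longleftrightarrow> (\<forall>b'<b. ord_add (ord_mult a b') a \<le> c)"
  by (subst ord_mult.simps) (auto simp: ord_sup_le_iff countable_lessThan_omega1)

lemma omega_pow_le_iff: "omega_pow a \<le> c \<longleftrightarrow> 1 \<le> c \<and> (\<forall>b<a. ord_mult (omega_pow b) ord_omega \<le> c)"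
  by (subst omega_pow.simps) (auto simp: ord_sup_le_iff countable_lessThan_omega1)

lemma ord_add_ge: "a \<le> ord_add a b"
  using ord_add_le_iff[of a b] by blast

lemma ord_add_strict_mono: "b' < b \<Longrightarrow> ord_add a b' < ord_add a b"
  using ord_add_le_iff[of a b "ord_add a b"] by blast

lemma ord_add_mono: "b' \<le> b \<Longrightarrow> ord_add a b' \<le> ord_add a b"
  using ord_add_strict_mono by (auto simp: le_less)

lemma ord_add_left_mono: "a \<le> a' \<Longrightarrow> ord_add a b \<le> ord_add a' b"
proof (induction b rule: less_induct)
  case (less b)
  then show ?case
    unfolding ord_add_le_iff[of a b]
    using ord_add_ge[of a' b] ord_add_strict_mono[of _ b a'] le_less_trans order.trans by blast
qed

lemma ord_add_zero [simp]: "ord_add a 0 = a"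
  by (rule eq_by_le_iff) (simp add: ord_add_le_iff)

lemma ord_add_suc: "ord_add a (ord_suc b) = ord_suc (ord_add a b)"
proof (rule antisym)
  have "a \<le> ord_suc (ord_add a b)"
    using ord_add_ge[of a b] less_ord_suc[of "ord_add a b"] by simp
  then show "ord_add a (ord_suc b) \<le> ord_suc (ord_add a b)"
    by (simp add: ord_add_le_iff[of a "ord_suc b"] less_ord_suc_iff ord_add_mono)
  show "ord_suc (ord_add a b) \<le> ord_add a (ord_suc b)"
    by (simp add: ord_suc_le_iff ord_add_strict_mono less_ord_suc)
qed

lemma ord_add_limit:
  assumes "0 < l" "\<And>b. b < l \<Longrightarrow> ord_suc b < l"
  shows "ord_add a l = ord_sup (ord_add a ` {..<l})"
proof (rule eq_by_le_iff)
  fix c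
  have "a \<le> c" if "\<forall>b<l. ord_add a b \<le> c"
    using that assms(1) by (metis ord_add_zero)
  moreover have "ord_add a b < c" if "\<forall>b<l. ord_add a b \<le> c" "b < l" for b
    using that assms(2)[OF that(2)] ord_add_strict_mono[OF less_ord_suc]
    by (meson order.strict_trans2)
  ultimately show "ord_add a l \<le> c \<longleftrightarrow> ord_sup (ord_add a ` {..<l}) \<le> c"
    by (auto simp: ord_add_le_iff[of a l] ord_sup_le_iff countable_lessThan_omega1)
qed

lemma zero_ord_add [simp]: "ord_add 0 a = a"
proof (induction a rule: less_induct)
  case (less a)
  have "(\<forall>b<a. b < c) \<longleftrightarrow> a \<le> c" for c
    by (meson less_le_trans less_irrefl not_le)
  then have "ord_add 0 a \<le> c \<longleftrightarrow> a \<le> c" for c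
    using less by (simp add: ord_add_le_iff[of 0 a])
  then show ?case
    by (rule eq_by_le_iff)
qed

lemma ord_mult_zero [simp]: "ord_mult a 0 = 0"
  by (rule eq_by_le_iff) (simp add: ord_mult_le_iff)

lemma ord_mult_mono: "b' \<le> b \<Longrightarrow> ord_mult a b' \<le> ord_mult a b"
  unfolding ord_mult_le_iff[of a b'] using ord_mult_le_iff[of a b "ord_mult a b"]
  by (simp add: less_le_trans)

lemma ord_mult_suc: "ord_mult a (ord_suc b) = ord_add (ord_mult a b) a"
proof (rule eq_by_le_iff)
  fix c
  show "ord_mult a (ord_suc b) \<le> c \<longleftrightarrow> ord_add (ord_mult a b) a \<le> c"
    unfolding ord_mult_le_iff[of a "ord_suc b"] less_ord_suc_iff
    by (meson ord_add_left_mono ord_mult_mono order.refl order.trans)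
qed

lemma ord_mult_limit:
  assumes "\<And>b. b < l \<Longrightarrow> ord_suc b < l"
  shows "ord_mult a l = ord_sup (ord_mult a ` {..<l})"
proof (rule eq_by_le_iff)
  fix c
  have "ord_add (ord_mult a b) a \<le> c" if "\<forall>b<l. ord_mult a b \<le> c" "b < l" for b
    using that assms by (metis ord_mult_suc)
  moreover have "ord_mult a b \<le> c" if "\<forall>b<l. ord_add (ord_mult a b) a \<le> c" "b < l" for b
    using that ord_add_ge order.trans by blast
  ultimately show "ord_mult a l \<le> c \<longleftrightarrow> ord_sup (ord_mult a ` {..<l}) \<le> c"
    by (auto simp: ord_mult_le_iff[of a l] ord_sup_le_iff countable_lessThan_omega1)
qed

lemma ord_mult_left_mono: "a \<le> a' \<Longrightarrow> ord_mult a b \<le> ord_mult a' b"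
proof (induction b rule: less_induct)
  case (less b)
  have "ord_add (ord_mult a b') a \<le> ord_mult a' b" if "b' < b" for b'
  proof -
    have "ord_add (ord_mult a b') a \<le> ord_add (ord_mult a' b') a'"
      using less that by (meson ord_add_left_mono ord_add_mono order.trans)
    also have "\<dots> \<le> ord_mult a' b"
      using that ord_mult_le_iff[of a' b "ord_mult a' b"] by blast
    finally show ?thesis .
  qed
  then show ?case
    by (simp add: ord_mult_le_iff[of a b])
qed

lemma ord_mult_omega_ge: "a \<le> ord_mult a ord_omega"
proof -
  have "ord_add (ord_mult a 0) a \<le> ord_mult a ord_omega"
    using ord_mult_le_iff[of a ord_omega "ord_mult a ord_omega"] ord_omega_limit(1) by blast
  then show ?thesis
    by simp
qed

lemma omega_pow_zero: "omega_pow 0 = 1"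
  by (rule eq_by_le_iff) (simp add: omega_pow_le_iff)

lemma omega_pow_mono: "a \<le> b \<Longrightarrow> omega_pow a \<le> omega_pow b"
  unfolding omega_pow_le_iff[of a] using omega_pow_le_iff[of b "omega_pow b"]
  by (simp add: less_le_trans)

lemma omega_pow_suc: "omega_pow (ord_suc a) = ord_mult (omega_pow a) ord_omega"
proof (rule eq_by_le_iff)
  fix c
  have "1 \<le> omega_pow a"
    using omega_pow_le_iff[of a "omega_pow a"] by blast
  then have "1 \<le> ord_mult (omega_pow a) ord_omega"
    using ord_mult_omega_ge order.trans by blast
  then show "omega_pow (ord_suc a) \<le> c \<longleftrightarrow> ord_mult (omega_pow a) ord_omega \<le> c"
    unfolding omega_pow_le_iff[of "ord_suc a"] less_ord_suc_iff
    by (meson ord_mult_left_mono omega_pow_mono order.refl order.trans)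
qed

lemma omega_pow_limit:
  assumes "0 < l" "\<And>b. b < l \<Longrightarrow> ord_suc b < l"
  shows "omega_pow l = ord_sup (omega_pow ` {..<l})"
proof (rule eq_by_le_iff)
  fix c
  have "1 \<le> c" if "\<forall>b<l. omega_pow b \<le> c"
    using that assms(1) by (metis omega_pow_zero)
  moreover have "ord_mult (omega_pow b) ord_omega \<le> c" if "\<forall>b<l. omega_pow b \<le> c" "b < l" for b
    using that assms(2) by (metis omega_pow_suc)
  moreover have "omega_pow b \<le> c" if "\<forall>b<l. ord_mult (omega_pow b) ord_omega \<le> c" "b < l" for b
    using that ord_mult_omega_ge order.trans by blast
  ultimately show "omega_pow l \<le> c \<longleftrightarrow> ord_sup (omega_pow ` {..<l}) \<le> c"
    by (auto simp: omega_pow_le_iff[of l] ord_sup_le_iff countable_lessThan_omega1)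
qed

section \<open>Terms and their labeled trees\<close>

text \<open>\<open>ShiftT \<alpha> u\<close>, \<open>FQ q us\<close> and \<open>FOrd \<alpha> us\<close> are \<open>s\<^sub>\<alpha>(u)\<close>, \<open>F\<^sub>q(us 0, us 1, \<dots>)\<close> and
  \<open>F\<^sub>\<alpha>(us 0, us 1, \<dots>)\<close>; in \<open>FOrd\<close> the argument \<open>us 0\<close> goes into the label of the root.\<close>

datatype 'q trm =
    Const 'q
  | ShiftT omega1 "'q trm"
  | FQ 'q "nat \<Rightarrow> 'q trm"
  | FOrd omega1 "nat \<Rightarrow> 'q trm"

primrec tree_of :: "'q trm \<Rightarrow> nat list set" where
  "tree_of (Const q) = {[]}"
| "tree_of (ShiftT \<alpha> u) = {[]}"
| "tree_of (FQ q us) = insert [] (\<Union>i. (#) i ` tree_of (us i))"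
| "tree_of (FOrd \<alpha> us) = insert [] (\<Union>i. (#) i ` tree_of (us (Suc i)))"

primrec label_of :: "'q trm \<Rightarrow> nat list \<Rightarrow> 'q trm" where
  "label_of (Const q) = (\<lambda>\<tau>. Const q)"
| "label_of (ShiftT \<alpha> u) = (\<lambda>\<tau>. ShiftT \<alpha> u)"
| "label_of (FQ q us) = (\<lambda>\<tau>. case \<tau> of [] \<Rightarrow> Const q | i # \<rho> \<Rightarrow> label_of (us i) \<rho>)"
| "label_of (FOrd \<alpha> us) =
    (\<lambda>\<tau>. case \<tau> of [] \<Rightarrow> ShiftT \<alpha> (us 0) | i # \<rho> \<Rightarrow> label_of (us (Suc i)) \<rho>)"

lemma Nil_in_tree_of [simp]: "[] \<in> tree_of u"
  by (cases u) simp_all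

lemma prefix_closed_tree_of: "\<tau> @ \<rho> \<in> tree_of u \<Longrightarrow> \<tau> \<in> tree_of u"
proof (induction \<tau> arbitrary: u)
  case (Cons i \<tau>)
  then show ?case
    by (cases u) (simp_all add: image_iff)
qed simp

lemma infinite_branching_tree_of: "\<tau> @ [i] \<in> tree_of u \<Longrightarrow> \<tau> @ [j] \<in> tree_of u"
proof (induction \<tau> arbitrary: u)
  case Nil
  then show ?case
    by (cases u) (simp_all add: image_iff)
next
  case (Cons k \<tau>)
  then show ?case
    by (cases u) (simp_all add: image_iff)
qed

lemma well_founded_tree_of: "\<exists>n. map f [0..<n] \<notin> tree_of u"
proof (induction u arbitrary: f)
  case (Const q)
  have "map f [0..<1] \<notin> tree_of (Const q)"
    by simp
  then show ?case ..
next
  case (ShiftT \<alpha> u)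
  have "map f [0..<1] \<notin> tree_of (ShiftT \<alpha> u)"
    by simp
  then show ?case ..
next
  case (FQ q us)
  obtain n where "map (f \<circ> Suc) [0..<n] \<notin> tree_of (us (f 0))"
    using FQ.IH by blast
  moreover have "map f [0..<Suc n] = f 0 # map (f \<circ> Suc) [0..<n]"
    by (simp add: map_upt_Suc del: upt_Suc)
  ultimately have "map f [0..<Suc n] \<notin> tree_of (FQ q us)"
    by (auto simp del: upt_Suc)
  then show ?case ..
next
  case (FOrd \<alpha> us)
  obtain n where "map (f \<circ> Suc) [0..<n] \<notin> tree_of (us (Suc (f 0)))"
    using FOrd.IH by blast
  moreover have "map f [0..<Suc n] = f 0 # map (f \<circ> Suc) [0..<n]"
    by (simp add: map_upt_Suc del: upt_Suc)
  ultimately have "map f [0..<Suc n] \<notin> tree_of (FOrd \<alpha> us)"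
    by (auto simp del: upt_Suc)
  then show ?case ..
qed

section \<open>Bases\<close>

text \<open>A base in \<open>X\<close> is represented by its sequence of levels; the carrier set is passed separately.
  The empty intersection in \<open>X\<close> is \<open>X\<close> itself.\<close>

type_synonym 'x base = "omega1 \<Rightarrow> 'x set set"

definition is_base :: "'x set \<Rightarrow> 'x base \<Rightarrow> bool" where
  "is_base X L \<longleftrightarrow>
     (\<forall>\<alpha>. L \<alpha> \<subseteq> Pow X \<and>
        (\<forall>\<U>. countable \<U> \<and> \<U> \<subseteq> L \<alpha> \<longrightarrow> \<Union>\<U> \<in> L \<alpha>) \<and>
        (\<forall>\<U>. finite \<U> \<and> \<U> \<subseteq> L \<alpha> \<longrightarrow> X \<inter> \<Inter>\<U> \<in> L \<alpha>)) \<and>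
     (\<forall>\<alpha> \<beta>. \<alpha> < \<beta> \<longrightarrow> (\<forall>S\<in>L \<alpha>. S \<in> L \<beta> \<and> X - S \<in> L \<beta>))"

definition shift_base :: "omega1 \<Rightarrow> 'x base \<Rightarrow> 'x base" where
  "shift_base \<beta> L = (\<lambda>\<alpha>. L (ord_add \<beta> \<alpha>))"

definition restrict_base :: "'x set \<Rightarrow> 'x base \<Rightarrow> 'x base" where
  "restrict_base U L = (\<lambda>\<alpha>. (\<inter>) U ` L \<alpha>)"

text \<open>\<open>Sigma0 X \<alpha>\<close> is meant for \<open>\<alpha> \<ge> 1\<close>; the empty level \<open>0\<close> contributes nothing to the recursion.\<close>

function Sigma0 :: "'x topology \<Rightarrow> omega1 \<Rightarrow> 'x set set" where
  "Sigma0 X \<alpha> =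
     (if \<alpha> = 0 then {}
      else if \<alpha> = 1 then {S. openin X S}
      else if \<alpha> = ord_suc 1 then
        {S. (countable union_of (\<lambda>D. \<exists>U V. openin X U \<and> openin X V \<and> D = U - V)) S}
      else
        {S. (countable union_of (\<lambda>C. \<exists>\<beta>\<in>{..<\<alpha>}. \<exists>B\<in>Sigma0 X \<beta>. C = topspace X - B)) S})"
  by pat_completeness auto
termination
proof (relation "inv_image {(x, y). x < y} snd")
  show "wf (inv_image {(x :: omega1, y). x < y} (snd :: 'x topology \<times> omega1 \<Rightarrow> omega1))"
    by (intro wf_inv_image wf)
qed simp

declare Sigma0.simps [simp del]

definition borel_base :: "'x topology \<Rightarrow> 'x base" where
  "borel_base X = (\<lambda>\<alpha>. Sigma0 X (ord_add 1 \<alpha>))"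

lemma is_base_shift:
  assumes "is_base X L"
  shows "is_base X (shift_base \<beta> L)"
proof -
  have "S \<in> L (ord_add \<beta> \<gamma>) \<and> X - S \<in> L (ord_add \<beta> \<gamma>)"
    if "\<alpha> < \<gamma>" "S \<in> L (ord_add \<beta> \<alpha>)" for \<alpha> \<gamma> S
    using assms that(2) ord_add_strict_mono[OF that(1), of \<beta>] by (simp add: is_base_def)
  then show ?thesis
    using assms by (simp add: is_base_def shift_base_def)
qed

lemma is_base_restrict:
  assumes L: "is_base X L" and U: "U \<subseteq> X"
  shows "is_base U (restrict_base U L)"
  unfolding is_base_def
proof (intro conjI allI impI ballI)
  fix \<alpha>
  show "restrict_base U L \<alpha> \<subseteq> Pow U"
    by (auto simp: restrict_base_def)
next
  fix \<alpha> \<U> assume "countable \<U> \<and> \<U> \<subseteq> restrict_base U L \<alpha>"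
  then obtain \<V> where "countable \<V>" "\<V> \<subseteq> L \<alpha>" "\<U> = (\<inter>) U ` \<V>"
    unfolding restrict_base_def by (metis countable_subset_image)
  then have "\<Union>\<V> \<in> L \<alpha>" "\<Union>\<U> = U \<inter> \<Union>\<V>"
    using L by (auto simp: is_base_def)
  then show "\<Union>\<U> \<in> restrict_base U L \<alpha>"
    by (simp add: restrict_base_def)
next
  fix \<alpha> \<U> assume "finite \<U> \<and> \<U> \<subseteq> restrict_base U L \<alpha>"
  then obtain \<V> where "finite \<V>" "\<V> \<subseteq> L \<alpha>" "\<U> = (\<inter>) U ` \<V>"
    unfolding restrict_base_def by (metis finite_subset_image)
  then have "X \<inter> \<Inter>\<V> \<in> L \<alpha>" "U \<inter> \<Inter>\<U> = U \<inter> (X \<inter> \<Inter>\<V>)"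
    using L U by (auto simp: is_base_def)
  then show "U \<inter> \<Inter>\<U> \<in> restrict_base U L \<alpha>"
    by (simp add: restrict_base_def)
next
  fix \<alpha> \<beta> S assume "\<alpha> < \<beta>" "S \<in> restrict_base U L \<alpha>"
  then obtain S' where "S = U \<inter> S'" "S' \<in> L \<beta>" "X - S' \<in> L \<beta>"
    using L by (auto simp: restrict_base_def is_base_def)
  moreover have "U - (U \<inter> S') = U \<inter> (X - S')"
    using U by blast
  ultimately show "S \<in> restrict_base U L \<beta>" "U - S \<in> restrict_base U L \<beta>"
    by (auto simp: restrict_base_def)
qed

lemma Sigma0_1: "Sigma0 X 1 = {S. openin X S}"
proof -
  have "(1 :: omega1) \<noteq> 0"
    using less_ord_suc[of 0] by (simp add: one_omega1_def)
  then show ?thesis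
    by (subst Sigma0.simps) simp
qed

lemma Sigma0_2:
  "Sigma0 X (ord_suc 1) =
     {S. (countable union_of (\<lambda>D. \<exists>U V. openin X U \<and> openin X V \<and> D = U - V)) S}"
proof -
  have "ord_suc 1 \<noteq> 0" "ord_suc 1 \<noteq> 1"
    using less_ord_suc[of 1] by (metis not_less_zero_omega1, metis less_irrefl)
  then show ?thesis
    by (subst Sigma0.simps) simp
qed

lemma Sigma0_ge_3:
  assumes "ord_suc 1 < \<alpha>"
  shows "Sigma0 X \<alpha> =
     {S. (countable union_of (\<lambda>C. \<exists>\<beta>\<in>{..<\<alpha>}. \<exists>B\<in>Sigma0 X \<beta>. C = topspace X - B)) S}"
proof -
  have "\<alpha> \<noteq> 0" "\<alpha> \<noteq> 1" "\<alpha> \<noteq> ord_suc 1"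
    using assms less_ord_suc[of 1] by auto
  then show ?thesis
    by (subst Sigma0.simps) simp
qed

lemma omega1_cases_1_2:
  obtains "\<alpha> = (0 :: omega1)" | "\<alpha> = 1" | "\<alpha> = ord_suc 1" | "ord_suc 1 < \<alpha>"
proof -
  have "\<alpha> = 0 \<or> 1 \<le> \<alpha>"
    unfolding one_omega1_def ord_suc_le_iff using zero_le_omega1[of \<alpha>] by (auto simp: le_less)
  moreover have "\<alpha> = 1 \<or> ord_suc 1 \<le> \<alpha>" if "1 \<le> \<alpha>"
    unfolding ord_suc_le_iff using that by (auto simp: le_less)
  ultimately show thesis
    using that by (auto simp: le_less)
qed

lemma Sigma0_0: "Sigma0 X 0 = {}"
  by (subst Sigma0.simps) simp

lemma Sigma0_subset: "S \<in> Sigma0 X \<alpha> \<Longrightarrow> S \<subseteq> topspace X"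
proof (cases \<alpha> rule: omega1_cases_1_2)
  case 3
  assume "S \<in> Sigma0 X \<alpha>"
  then show ?thesis
    unfolding 3 Sigma0_2 union_of_def by clarsimp (blast dest: openin_subset)
next
  case 4
  assume "S \<in> Sigma0 X \<alpha>"
  then show ?thesis
    unfolding Sigma0_ge_3[OF 4] union_of_def by auto
qed (simp_all add: Sigma0_0 Sigma0_1 openin_subset)

lemma Sigma0_Union:
  assumes "1 \<le> \<alpha>" "countable \<U>" "\<U> \<subseteq> Sigma0 X \<alpha>"
  shows "\<Union>\<U> \<in> Sigma0 X \<alpha>"
proof (cases \<alpha> rule: omega1_cases_1_2)
  case 1
  then show ?thesis
    using assms(1) less_ord_suc[of 0] by (simp add: one_omega1_def not_less[symmetric])
next
  case 2
  then show ?thesis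
    using assms by (auto simp: Sigma0_1)
next
  case 3
  then show ?thesis
    using assms by (auto simp: Sigma0_2 intro: countable_union_of_Union)
next
  case 4
  show ?thesis
    using assms unfolding Sigma0_ge_3[OF 4] by (auto intro: countable_union_of_Union)
qed

lemma Sigma0_Un: "1 \<le> \<alpha> \<Longrightarrow> S \<in> Sigma0 X \<alpha> \<Longrightarrow> T \<in> Sigma0 X \<alpha> \<Longrightarrow> S \<union> T \<in> Sigma0 X \<alpha>"
  using Sigma0_Union[of \<alpha> "{S, T}" X] by simp

lemma Sigma0_less:
  assumes "\<alpha> < \<beta>" "S \<in> Sigma0 X \<alpha>"
  shows "S \<in> Sigma0 X \<beta>" "topspace X - S \<in> Sigma0 X \<beta>"
proof -
  have S: "S \<subseteq> topspace X"
    using assms(2) by (rule Sigma0_subset)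
  have "S \<in> Sigma0 X \<beta> \<and> topspace X - S \<in> Sigma0 X \<beta>"
  proof (cases \<beta> rule: omega1_cases_1_2)
    case 1
    then show ?thesis
      using assms by simp
  next
    case 2
    then have "\<alpha> = 0"
      using assms(1) by (simp add: one_omega1_def less_ord_suc_iff antisym)
    then show ?thesis
      using assms(2) by (simp add: Sigma0_0)
  next
    case 3
    then have "\<alpha> \<le> 1"
      using assms(1) by (simp add: less_ord_suc_iff)
    moreover have "\<alpha> \<noteq> 0"
      using assms(2) by (auto simp: Sigma0_0)
    ultimately have "\<alpha> = 1"
      using less_ord_suc[of 1] by (cases \<alpha> rule: omega1_cases_1_2) auto
    then have "openin X S"
      using assms(2) by (simp add: Sigma0_1)
    moreover have "S = S - {}"
      by simp
    ultimately show ?thesis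
      unfolding 3 Sigma0_2
      by (metis (mono_tags, lifting) countable_union_of_inc mem_Collect_eq openin_empty openin_topspace)
  next
    case 4
    have compl: "topspace X - B \<in> Sigma0 X \<beta>" if "\<gamma> < \<beta>" "B \<in> Sigma0 X \<gamma>" for \<gamma> B
      unfolding Sigma0_ge_3[OF 4] using that by (auto intro!: countable_union_of_inc)
    have "S \<in> Sigma0 X \<beta>"
    proof (cases \<alpha> rule: omega1_cases_1_2)
      case 1
      then show ?thesis
        using assms by (simp add: Sigma0_0)
    next
      case 2
      then have "openin X S"
        using assms(2) by (simp add: Sigma0_1)
      then have "topspace X - S \<in> Sigma0 X (ord_suc 1)"
        unfolding Sigma0_2 by (auto intro!: countable_union_of_inc)
      then show ?thesis
        using compl[OF 4] S by (metis double_diff order_refl)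
    next
      case 3
      have piece: "U - V \<in> Sigma0 X \<beta>" if "openin X U" "openin X V" for U V
      proof -
        have "topspace X - U \<in> Sigma0 X (ord_suc 1)"
          unfolding Sigma0_2 using that by (auto intro!: countable_union_of_inc)
        moreover have "V = V - {}"
          by simp
        then have "V \<in> Sigma0 X (ord_suc 1)"
          unfolding Sigma0_2 using that
          by (metis (mono_tags, lifting) countable_union_of_inc mem_Collect_eq openin_empty)
        ultimately have "(topspace X - U) \<union> V \<in> Sigma0 X (ord_suc 1)"
          using less_ord_suc[of 1] by (intro Sigma0_Un) auto
        moreover have "topspace X - ((topspace X - U) \<union> V) = U - V"
          using openin_subset[OF that(1)] by blast
        ultimately show ?thesis
          using compl[OF 4] by metis
      qed
      obtain \<U> where "countable \<U>" "\<U> \<subseteq> {D. \<exists>U V. openin X U \<and> openin X V \<and> D = U - V}" "S = \<Union>\<U>"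
        using assms(2) unfolding 3 Sigma0_2 union_of_def by auto
      moreover from this(2) have "\<U> \<subseteq> Sigma0 X \<beta>"
        using piece by auto
      moreover have "1 \<le> \<beta>"
        using 4 less_ord_suc[of 1] by simp
      ultimately show ?thesis
        using Sigma0_Union by metis
    next
      case alpha: 4
      obtain \<U> where "countable \<U>"
          "\<U> \<subseteq> {C. \<exists>\<gamma>\<in>{..<\<alpha>}. \<exists>B\<in>Sigma0 X \<gamma>. C = topspace X - B}" "S = \<Union>\<U>"
        using assms(2) unfolding Sigma0_ge_3[OF alpha] union_of_def by auto
      moreover from this(2) have "\<U> \<subseteq> Sigma0 X \<beta>"
        using compl assms(1) by (force dest: less_trans)
      moreover have "1 \<le> \<beta>"
        using 4 less_ord_suc[of 1] by simp
      ultimately show ?thesis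
        using Sigma0_Union by metis
    qed
    then show ?thesis
      using compl assms by simp
  qed
  then show "S \<in> Sigma0 X \<beta>" "topspace X - S \<in> Sigma0 X \<beta>"
    by auto
qed

lemma Sigma0_mono: "\<alpha> \<le> \<beta> \<Longrightarrow> S \<in> Sigma0 X \<alpha> \<Longrightarrow> S \<in> Sigma0 X \<beta>"
  by (cases "\<alpha> = \<beta>") (simp_all add: Sigma0_less(1)[of \<alpha>])

lemma Sigma0_Int:
  assumes "S \<in> Sigma0 X \<alpha>" "T \<in> Sigma0 X \<alpha>"
  shows "S \<inter> T \<in> Sigma0 X \<alpha>"
proof (cases \<alpha> rule: omega1_cases_1_2)
  case 1
  then show ?thesis
    using assms by (simp add: Sigma0_0)
next
  case 2
  then show ?thesis
    using assms by (simp add: Sigma0_1 openin_Int)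
next
  case 3
  have "\<exists>U V. openin X U \<and> openin X V \<and> D \<inter> D' = U - V"
    if D: "\<exists>U V. openin X U \<and> openin X V \<and> D = U - V" "\<exists>U V. openin X U \<and> openin X V \<and> D' = U - V"
    for D D'
  proof -
    obtain U V U' V' where "openin X U" "openin X V" "D = U - V" "openin X U'" "openin X V'" "D' = U' - V'"
      using D by (elim exE conjE)
    then have "openin X (U \<inter> U')" "openin X (V \<union> V')" "D \<inter> D' = (U \<inter> U') - (V \<union> V')"
      by auto
    then show ?thesis
      by blast
  qed
  then show ?thesis
    unfolding 3 Sigma0_2 mem_Collect_eq
    by (intro countable_union_of_Int[OF assms[unfolded 3 Sigma0_2 mem_Collect_eq]]) (elim conjE)
next
  case 4
  have "\<exists>\<beta>\<in>{..<\<alpha>}. \<exists>B\<in>Sigma0 X \<beta>. C \<inter> C' = topspace X - B"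
    if C: "\<exists>\<beta>\<in>{..<\<alpha>}. \<exists>B\<in>Sigma0 X \<beta>. C = topspace X - B"
      and C': "\<exists>\<beta>\<in>{..<\<alpha>}. \<exists>B\<in>Sigma0 X \<beta>. C' = topspace X - B" for C C'
  proof -
    obtain \<beta> B \<gamma> B' where B: "\<beta> < \<alpha>" "B \<in> Sigma0 X \<beta>" "C = topspace X - B"
      and B': "\<gamma> < \<alpha>" "B' \<in> Sigma0 X \<gamma>" "C' = topspace X - B'"
      using C C' unfolding lessThan_iff by (elim bexE) simp
    define \<delta> where "\<delta> = max \<beta> \<gamma>"
    have "B \<in> Sigma0 X \<delta>" "B' \<in> Sigma0 X \<delta>"
      using Sigma0_mono[OF _ B(2), of \<delta>] Sigma0_mono[OF _ B'(2), of \<delta>] by (simp_all add: \<delta>_def)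
    moreover from this have "1 \<le> \<delta>"
      by (cases \<delta> rule: omega1_cases_1_2) (use less_ord_suc[of 1] in \<open>auto simp: Sigma0_0\<close>)
    ultimately have "B \<union> B' \<in> Sigma0 X \<delta>"
      by (intro Sigma0_Un)
    moreover have "\<delta> < \<alpha>" "C \<inter> C' = topspace X - (B \<union> B')"
      using B B' by (auto simp: \<delta>_def)
    ultimately show ?thesis
      by (intro bexI[of _ "B \<union> B'"] bexI[of _ \<delta>]) simp_all
  qed
  then show ?thesis
    unfolding Sigma0_ge_3[OF 4] mem_Collect_eq
    by (intro countable_union_of_Int[OF assms[unfolded Sigma0_ge_3[OF 4] mem_Collect_eq]]) (elim conjE)
qed

lemma is_base_borel_base: "is_base (topspace X) (borel_base X)"
  unfolding is_base_def borel_base_def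
proof (intro conjI allI impI ballI)
  fix \<alpha>
  show "Sigma0 X (ord_add 1 \<alpha>) \<subseteq> Pow (topspace X)"
    using Sigma0_subset by blast
next
  fix \<alpha> \<U> assume "countable \<U> \<and> \<U> \<subseteq> Sigma0 X (ord_add 1 \<alpha>)"
  then show "\<Union>\<U> \<in> Sigma0 X (ord_add 1 \<alpha>)"
    by (intro Sigma0_Union ord_add_ge) auto
next
  fix \<alpha> \<U> assume \<U>: "finite \<U> \<and> \<U> \<subseteq> Sigma0 X (ord_add 1 \<alpha>)"
  have top: "topspace X \<in> Sigma0 X (ord_add 1 \<alpha>)"
    using Sigma0_less(1)[of 1 _ "topspace X" X] ord_add_ge[of 1 \<alpha>]
    by (metis Sigma0_1 le_less mem_Collect_eq openin_topspace)
  have "finite \<U>" "\<U> \<subseteq> Sigma0 X (ord_add 1 \<alpha>)"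
    using \<U> by auto
  then show "topspace X \<inter> \<Inter>\<U> \<in> Sigma0 X (ord_add 1 \<alpha>)"
  proof (induction \<U> rule: finite_induct)
    case (insert S \<U>)
    then have "S \<in> Sigma0 X (ord_add 1 \<alpha>)" "topspace X \<inter> \<Inter>\<U> \<in> Sigma0 X (ord_add 1 \<alpha>)"
      by auto
    then have "S \<inter> (topspace X \<inter> \<Inter>\<U>) \<in> Sigma0 X (ord_add 1 \<alpha>)"
      by (rule Sigma0_Int)
    then show ?case
      by (simp add: Int_left_commute)
  qed (simp add: top)
next
  fix \<alpha> \<beta> :: omega1 and S assume "\<alpha> < \<beta>" "S \<in> Sigma0 X (ord_add 1 \<alpha>)"
  then show "S \<in> Sigma0 X (ord_add 1 \<beta>)" "topspace X - S \<in> Sigma0 X (ord_add 1 \<beta>)"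
    by (simp_all add: Sigma0_less[OF ord_add_strict_mono])
qed

section \<open>Families\<close>

definition component :: "nat list set \<Rightarrow> (nat list \<Rightarrow> 'x set) \<Rightarrow> nat list \<Rightarrow> 'x set" where
  "component T U \<tau> = U \<tau> - \<Union>{U \<tau>' | \<tau>'. \<tau>' \<in> T \<and> strict_prefix \<tau> \<tau>'}"

text \<open>\<open>Leaf X\<close> stands for the family \<open>{X}\<close>, and \<open>Node U F\<close> for the pair of \<open>{U \<tau>}\<close> and \<open>{F \<tau>}\<close>;
  the functions \<open>U\<close> and \<open>F\<close> are irrelevant outside the tree.\<close>

datatype 'x fam =
    Leaf "'x set"
  | Node "nat list \<Rightarrow> 'x set" "nat list \<Rightarrow> 'x fam"

definition is_F_term :: "'q trm \<Rightarrow> bool" where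
  "is_F_term u \<longleftrightarrow> (\<exists>q us. u = FQ q us) \<or> (\<exists>\<alpha> us. u = FOrd \<alpha> us)"

text \<open>The labels occurring in the premises of the \<open>Node\<close> rule have the form \<open>Const q\<close> or
  \<open>ShiftT \<alpha> v\<close> with \<open>v\<close> a proper subterm of \<open>u\<close>, so both inductive predicates below are
  determined by recursion on the term.\<close>

inductive is_family :: "'q trm \<Rightarrow> 'x set \<Rightarrow> 'x base \<Rightarrow> 'x fam \<Rightarrow> bool" where
  Const: "is_family (Const q) X L (Leaf X)"
| Shift: "is_family u X (shift_base (omega_pow \<alpha>) L) F \<Longrightarrow> is_family (ShiftT \<alpha> u) X L F"
| Node: "is_family u X L (Node U F)"
    if "is_F_term u"
      and "\<forall>\<tau>\<in>tree_of u. U \<tau> \<in> L 0"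
      and "\<forall>\<tau>\<in>tree_of u. \<forall>\<tau>'\<in>tree_of u. prefix \<tau> \<tau>' \<longrightarrow> U \<tau>' \<subseteq> U \<tau>"
      and "U [] = X"
      and "\<forall>\<tau>\<in>tree_of u.
             is_family (label_of u \<tau>) (component (tree_of u) U \<tau>)
               (restrict_base (component (tree_of u) U \<tau>) L) (F \<tau>)"

text \<open>Only the values of \<open>A\<close> on the carrier \<open>X\<close> matter, so \<open>A\<close> also represents its restrictions.\<close>

inductive determines :: "'q trm \<Rightarrow> 'x set \<Rightarrow> 'x base \<Rightarrow> 'x fam \<Rightarrow> ('x \<Rightarrow> 'q) \<Rightarrow> bool" where
  Const: "\<forall>x\<in>X. A x = q \<Longrightarrow> determines (Const q) X L (Leaf X) A"
| Shift: "determines u X (shift_base (omega_pow \<alpha>) L) F A \<Longrightarrow> determines (ShiftT \<alpha> u) X L F A"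
| Node: "determines u X L (Node U F) A"
    if "is_F_term u"
      and "\<forall>\<tau>\<in>tree_of u.
             determines (label_of u \<tau>) (component (tree_of u) U \<tau>)
               (restrict_base (component (tree_of u) U \<tau>) L) (F \<tau>) A"

definition level_class :: "'x set \<Rightarrow> 'x base \<Rightarrow> 'q trm \<Rightarrow> ('x \<Rightarrow> 'q) set" where
  "level_class X L u = {A. \<exists>F. is_family u X L F \<and> determines u X L F A}"

section \<open>Wadge reducibility\<close>

definition wadge_le :: "'x topology \<Rightarrow> ('q \<Rightarrow> 'q \<Rightarrow> bool) \<Rightarrow> ('x \<Rightarrow> 'q) \<Rightarrow> ('x \<Rightarrow> 'q) \<Rightarrow> bool" where
  "wadge_le X leQ A B \<longleftrightarrow>
     (\<exists>f. continuous_map X X f \<and> (\<forall>x\<in>topspace X. leQ (A x) (B (f x))))"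

end

theory Submission
  imports Defs
begin

text \<open>
  Over an antichain, \<open>A \<le>\<^sub>W B\<close> says that \<open>A = B \<circ> f\<close> on the space for some continuous \<open>f\<close>, so it
  suffices to pull a family determining \<open>B\<close> back along \<open>f\<close>, replacing every set \<open>S\<close> occurring in it
  by its preimage.  Preimages commute with unions and differences, hence with passing to
  components, and they respect inclusion; so the pulled back family has the same shape as the
  original one and determines \<open>B \<circ> f\<close> (\<open>determines_pullback\<close>).

  The levels of the base behave well because a continuous preimage of a \<open>\<Sigma>\<^sup>0\<^sub>\<alpha>\<close> set is
  \<open>\<Sigma>\<^sup>0\<^sub>\<alpha>\<close> (\<open>Sigma0_vimage\<close>).  That property of a pair of bases survives both shifting them and
  restricting them to a set and its preimage, the two operations used in the definition of
  families, so an induction on the family carries it to all subfamilies (\<open>is_family_pullback\<close>).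
\<close>

section \<open>Continuous preimages of Borel sets\<close>

lemma countable_union_of_vimage:
  assumes "(countable union_of P) S" and "\<And>D. P D \<Longrightarrow> Q (f -` D \<inter> X)"
  shows "(countable union_of Q) (f -` S \<inter> X)"
proof -
  obtain \<U> where \<U>: "countable \<U>" "\<U> \<subseteq> Collect P" "\<Union>\<U> = S"
    using assms(1) unfolding union_of_def by auto
  have "(countable union_of Q) (\<Union>((\<lambda>D. f -` D \<inter> X) ` \<U>))"
    unfolding union_of_def using \<U>(1,2) assms(2)
    by (intro exI[of _ "(\<lambda>D. f -` D \<inter> X) ` \<U>"]) auto
  also have "\<Union>((\<lambda>D. f -` D \<inter> X) ` \<U>) = f -` S \<inter> X"
    using \<U>(3) by auto
  finally show ?thesis .
qed

text \<open>Each level is obtained from open sets or lower levels by countable unions and differences,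
  and preimages commute with both.\<close>

lemma Sigma0_vimage:
  assumes f: "continuous_map X Y f"
  shows "S \<in> Sigma0 Y \<alpha> \<Longrightarrow> f -` S \<inter> topspace X \<in> Sigma0 X \<alpha>"
proof (induction \<alpha> arbitrary: S rule: less_induct)
  case (less \<alpha>)
  have openin_vimage: "openin X (f -` U \<inter> topspace X)" if "openin Y U" for U
    using openin_continuous_map_preimage[OF f that] by (simp add: vimage_def Int_def conj_commute)
  show ?case
  proof (cases \<alpha> rule: omega1_cases_1_2)
    case 1
    then show ?thesis
      using less.prems by (simp add: Sigma0_0)
  next
    case 2
    then show ?thesis
      using less.prems openin_vimage by (simp add: Sigma0_1)
  next
    case 3
    have "\<exists>U V. openin X U \<and> openin X V \<and> f -` D \<inter> topspace X = U - V"
      if D: "\<exists>U V. openin Y U \<and> openin Y V \<and> D = U - V" for D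
    proof -
      obtain U V where "openin Y U" "openin Y V" "D = U - V"
        using D by blast
      then show ?thesis
        using openin_vimage
        by (intro exI[of _ "f -` U \<inter> topspace X"] exI[of _ "f -` V \<inter> topspace X"]) auto
    qed
    then show ?thesis
      using less.prems unfolding 3 Sigma0_2 mem_Collect_eq by (rule countable_union_of_vimage[rotated])
  next
    case 4
    have "\<exists>\<beta>\<in>{..<\<alpha>}. \<exists>B\<in>Sigma0 X \<beta>. f -` C \<inter> topspace X = topspace X - B"
      if C: "\<exists>\<beta>\<in>{..<\<alpha>}. \<exists>B\<in>Sigma0 Y \<beta>. C = topspace Y - B" for C
    proof -
      obtain \<beta> B where B: "\<beta> < \<alpha>" "B \<in> Sigma0 Y \<beta>" "C = topspace Y - B"
        using C by auto
      have "f -` C \<inter> topspace X = topspace X - (f -` B \<inter> topspace X)"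
        using continuous_map_image_subset_topspace[OF f] B(3) by auto
      then show ?thesis
        using less.IH[OF B(1,2)] B(1) by blast
    qed
    then show ?thesis
      using less.prems unfolding Sigma0_ge_3[OF 4] mem_Collect_eq
      by (rule countable_union_of_vimage[rotated])
  qed
qed

section \<open>Pulling back families\<close>

text \<open>The set \<open>X\<close> stays the same in subfamilies, although their carriers shrink: a subfamily lives on
  a component \<open>C\<close>, its pullback on \<open>f -` C \<inter> X\<close>, and for subsets of \<open>C\<close> cutting the preimage down
  to \<open>X\<close> or to \<open>f -` C \<inter> X\<close> gives the same set.\<close>

primrec pullback_fam :: "('x \<Rightarrow> 'y) \<Rightarrow> 'x set \<Rightarrow> 'y fam \<Rightarrow> 'x fam" where
  "pullback_fam f X (Leaf Y) = Leaf (f -` Y \<inter> X)"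
| "pullback_fam f X (Node U F) = Node (\<lambda>\<tau>. f -` U \<tau> \<inter> X) (\<lambda>\<tau>. pullback_fam f X (F \<tau>))"

lemma component_vimage:
  "component T (\<lambda>\<tau>. f -` U \<tau> \<inter> X) \<tau> = f -` component T U \<tau> \<inter> X"
  by (auto simp: component_def)

text \<open>Stating the result on the carrier \<open>f -` Y \<inter> X\<close> instead of \<open>X\<close> lets the induction descend to the
  components \<open>C\<close>: the hypothesis passes from \<open>M\<close> and \<open>L\<close> to their restrictions to \<open>C\<close> and
  \<open>f -` C \<inter> X\<close>, while \<open>X\<close> stays fixed.\<close>

lemma is_family_pullback:
  assumes "is_family u Y M F"
    and "\<And>\<alpha> S. S \<in> M \<alpha> \<Longrightarrow> f -` S \<inter> X \<in> L \<alpha>"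
  shows "is_family u (f -` Y \<inter> X) L (pullback_fam f X F)"
  using assms
proof (induction arbitrary: L rule: is_family.induct)
  case (Const q Y M)
  then show ?case
    by (simp add: is_family.Const)
next
  case (Shift u Y \<alpha> M F)
  then show ?case
    by (intro is_family.Shift) (simp add: shift_base_def)
next
  case (Node u U M Y F)
  let ?C = "component (tree_of u) U"
  have restrict: "f -` S \<inter> X \<in> restrict_base (f -` C \<inter> X) L \<alpha>"
    if S: "S \<in> restrict_base C M \<alpha>" for \<alpha> S C
  proof -
    obtain S' where S': "S' \<in> M \<alpha>" "S = C \<inter> S'"
      using S by (auto simp: restrict_base_def)
    have "f -` S \<inter> X = (f -` C \<inter> X) \<inter> (f -` S' \<inter> X)"
      using S'(2) by auto
    then show ?thesis
      using Node.prems[OF S'(1)] by (auto simp: restrict_base_def)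
  qed
  have "is_family u (f -` Y \<inter> X) L
      (Node (\<lambda>\<tau>. f -` U \<tau> \<inter> X) (\<lambda>\<tau>. pullback_fam f X (F \<tau>)))"
  proof (rule is_family.Node)
    show "is_F_term u"
      by (fact Node)
    show "\<forall>\<tau>\<in>tree_of u. f -` U \<tau> \<inter> X \<in> L 0"
      using Node.hyps Node.prems by blast
    show "\<forall>\<tau>\<in>tree_of u. \<forall>\<tau>'\<in>tree_of u. prefix \<tau> \<tau>' \<longrightarrow> f -` U \<tau>' \<inter> X \<subseteq> f -` U \<tau> \<inter> X"
      using Node.hyps by blast
    show "f -` U [] \<inter> X = f -` Y \<inter> X"
      using Node.hyps by simp
    show "\<forall>\<tau>\<in>tree_of u. is_family (label_of u \<tau>)
        (component (tree_of u) (\<lambda>\<tau>. f -` U \<tau> \<inter> X) \<tau>)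
        (restrict_base (component (tree_of u) (\<lambda>\<tau>. f -` U \<tau> \<inter> X) \<tau>) L)
        (pullback_fam f X (F \<tau>))"
      unfolding component_vimage using Node.IH restrict by blast
  qed
  then show ?case
    by simp
qed

lemma determines_pullback:
  assumes "determines u Y M F B" and "\<And>x. x \<in> X \<Longrightarrow> A x = B (f x)"
  shows "determines u (f -` Y \<inter> X) L (pullback_fam f X F) A"
  using assms
proof (induction arbitrary: L rule: determines.induct)
  case (Const Y B q M)
  then show ?case
    by (simp add: determines.Const)
next
  case (Shift u Y \<alpha> M F B)
  then show ?case
    by (intro determines.Shift) simp
next
  case (Node u U M F B Y)
  then show ?case
    by (simp add: determines.Node component_vimage)
qed

theorem corollary2:
  fixes X :: "'x topology"
    and leQ :: "'q \<Rightarrow> 'q \<Rightarrow> bool"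
    and u :: "'q trm"
    and A B :: "'x \<Rightarrow> 'q"
  assumes "leQ = (=)"
    and "second_countable X" and "t0_space X"
    and "B \<in> level_class (topspace X) (borel_base X) u"
    and "wadge_le X leQ A B"
  shows "A \<in> level_class (topspace X) (borel_base X) u"
proof -
  obtain f where f: "continuous_map X X f" and A: "\<And>x. x \<in> topspace X \<Longrightarrow> A x = B (f x)"
    using assms(1,5) unfolding wadge_le_def by blast
  obtain F where F: "is_family u (topspace X) (borel_base X) F"
      "determines u (topspace X) (borel_base X) F B"
    using assms(4) unfolding level_class_def by blast
  have carrier: "f -` topspace X \<inter> topspace X = topspace X"
    using continuous_map_image_subset_topspace[OF f] by auto
  have "is_family u (topspace X) (borel_base X) (pullback_fam f (topspace X) F)"
    using is_family_pullback[OF F(1), of f "topspace X" "borel_base X"] Sigma0_vimage[OF f] carrier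
    by (simp add: borel_base_def)
  moreover have "determines u (topspace X) (borel_base X) (pullback_fam f (topspace X) F) A"
    using determines_pullback[OF F(2), of "topspace X" A f "borel_base X"] A carrier by simp
  ultimately show ?thesis
    unfolding level_class_def by blast
qed

end
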